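(* If $c:\mathbb{X}\times\mathbb{U}\to\mathbb{R}$ is a non-negative, measurable and bounded function, then for all $P_n,P\in\mathcal{P}(\mathbb{X})$, $$|J^*_\beta(P_n,\mathcal{T})-J^*_\beta(P,\mathcal{T})|\le\|P_n-P\|_{TV}\,\frac{1}{1-\beta}\,\|c\|_\infty .$$
   Context: $\mathbb{X}\subset\mathbb{R}^n$, $\mathbb{Y}\subset\mathbb{R}^m$ and $\mathbb{U}$ (a subset of some Euclidean space) are Borel sets; $\mathcal{P}(\mathbb{X})$ is the set of Borel probability measures on $\mathbb{X}$. $Q(\cdot|x)$ (the channel) is a stochastic kernel from $\mathbb{X}$ to $\mathbb{Y}$ and $\mathcal{T}(\cdot|x,u)$ is a stochastic kernel from $\mathbb{X}\times\mathbb{U}$ to $\mathbb{X}$. An admissible policy is a sequence $\gamma=\{\gamma_t\}_{t\ge0}$ of measurable control functions with $U_t=\gamma_t(I_t)\in\mathbb{U}$, where $I_0=\{Y_0\}$, $I_t=\{Y_0,\dots,Y_t,U_0,\dots,U_{t-1}\}$; $\Gamma$ is the set of admissible policies. Given an initial law (prior) $P\in\mathcal{P}(\mathbb{X})$ and $\gamma\in\Gamma$, the process evolves as $X_0\sim P$, $Y_t\sim Q(\cdot|X_t)$ and $X_{t+1}\sim\mathcal{T}(\cdot|X_t,U_t)$ (conditionally on the past); $E_P^{\gamma}$ is the corresponding expectation. For fixed $\beta\in(0,1)$, $$J_\beta(P,\mathcal{T},\gamma)=E_P^{\gamma}\Big[\sum_{t=0}^\infty\beta^tc(X_t,U_t)\Big],\qquad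 J_\beta^*(P,\mathcal{T})=\inf_{\gamma\in\Gamma}J_\beta(P,\mathcal{T},\gamma),$$ with $Q$ fixed. $\|c\|_\infty$ is the supremum norm, and $\|\mu-\nu\|_{TV}=2\sup_B|\mu(B)-\nu(B)|$ over Borel sets $B$. *)

theory Defs
  imports "HOL-Probability.Probability"
begin

abbreviation borel_on :: "'a::topological_space set \<Rightarrow> 'a measure" where
  "borel_on A \<equiv> restrict_space borel A"

abbreviation borel_probs :: "'a::topological_space set \<Rightarrow> 'a measure set" where
  "borel_probs A \<equiv> space (prob_algebra (borel_on A))"

definition stochastic_kernel :: "'a measure \<Rightarrow> 'b measure \<Rightarrow> ('a \<Rightarrow> 'b measure) \<Rightarrow> bool" where
  "stochastic_kernel M N K \<longleftrightarrow> K \<in> M \<rightarrow>\<^sub>M prob_algebra N"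

text \<open>With this normalisation the distance takes values in \<open>[0, 2]\<close>.\<close>

definition tv_dist :: "'a measure \<Rightarrow> 'a measure \<Rightarrow> real" where
  "tv_dist \<mu> \<nu> = 2 * (SUP B\<in>sets \<mu>. \<bar>measure \<mu> B - measure \<nu> B\<bar>)"

text \<open>The inserted \<open>0\<close> only matters for empty \<open>A\<close>, where the supremum norm is \<open>0\<close>.\<close>

definition sup_norm_on :: "'a set \<Rightarrow> ('a \<Rightarrow> real) \<Rightarrow> real" where
  "sup_norm_on A f = Sup (insert 0 ((\<lambda>z. \<bar>f z\<bar>) ` A))"

text \<open>
  A policy \<open>\<gamma>\<close> maps a time \<open>t\<close> and the information \<open>((Y\<^sub>0, \<dots>, Y\<^sub>t), (U\<^sub>0, \<dots>, U\<^sub>t\<^sub>-\<^sub>1))\<close> to an action;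
  the two tuples are extensional functions on \<open>{0..t}\<close> and \<open>{0..<t}\<close>.
\<close>

type_synonym ('y, 'u) policy = "nat \<Rightarrow> (nat \<Rightarrow> 'y) \<times> (nat \<Rightarrow> 'u) \<Rightarrow> 'u"

definition admissible_policies ::
  "'y::topological_space set \<Rightarrow> 'u::topological_space set \<Rightarrow> ('y, 'u) policy set" where
  "admissible_policies Y U =
     {\<gamma>. \<forall>t. \<gamma> t \<in> (\<Pi>\<^sub>M i\<in>{0..t}. borel_on Y) \<Otimes>\<^sub>M (\<Pi>\<^sub>M i\<in>{0..<t}. borel_on U) \<rightarrow>\<^sub>M borel_on U}"

abbreviation stage_space ::
  "'x::topological_space set \<Rightarrow> 'y::topological_space set \<Rightarrow> 'u::topological_space set
   \<Rightarrow> ('x \<times> 'y \<times> 'u) measure" where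
  "stage_space X Y U \<equiv> borel_on X \<Otimes>\<^sub>M borel_on Y \<Otimes>\<^sub>M borel_on U"

text \<open>State, measurement and action at time \<open>t\<close> of a trajectory.\<close>

abbreviation state_at :: "(nat \<Rightarrow> 'x \<times> 'y \<times> 'u) \<Rightarrow> nat \<Rightarrow> 'x" where
  "state_at \<omega> t \<equiv> fst (\<omega> t)"

abbreviation meas_at :: "(nat \<Rightarrow> 'x \<times> 'y \<times> 'u) \<Rightarrow> nat \<Rightarrow> 'y" where
  "meas_at \<omega> t \<equiv> fst (snd (\<omega> t))"

abbreviation action_at :: "(nat \<Rightarrow> 'x \<times> 'y \<times> 'u) \<Rightarrow> nat \<Rightarrow> 'u" where
  "action_at \<omega> t \<equiv> snd (snd (\<omega> t))"

definition info ::
  "nat \<Rightarrow> (nat \<Rightarrow> 'x \<times> 'y \<times> 'u) \<Rightarrow> 'y \<Rightarrow> (nat \<Rightarrow> 'y) \<times> (nat \<Rightarrow> 'u)" where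
  "info t \<omega> y = (\<lambda>i\<in>{0..t}. if i = t then y else meas_at \<omega> i, \<lambda>i\<in>{0..<t}. action_at \<omega> i)"

text \<open>
  Conditional law of \<open>(X\<^sub>t, Y\<^sub>t, U\<^sub>t)\<close> given the trajectory \<open>\<omega>\<close> on \<open>{0..<t}\<close>.
\<close>

definition stage_law ::
  "'x::topological_space set \<Rightarrow> 'y::topological_space set \<Rightarrow> 'u::topological_space set
   \<Rightarrow> ('x \<Rightarrow> 'y measure) \<Rightarrow> 'x measure \<Rightarrow> ('x \<times> 'u \<Rightarrow> 'x measure) \<Rightarrow> ('y, 'u) policy
   \<Rightarrow> nat \<Rightarrow> (nat \<Rightarrow> 'x \<times> 'y \<times> 'u) \<Rightarrow> ('x \<times> 'y \<times> 'u) measure" where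
  "stage_law X Y U Q P T \<gamma> t \<omega> =
     (if t = 0 then P else T (state_at \<omega> (t - 1), action_at \<omega> (t - 1))) \<bind> (\<lambda>x.
     Q x \<bind> (\<lambda>y.
     return (stage_space X Y U) (x, y, \<gamma> t (info t \<omega> y))))"

text \<open>
  The law of the whole process \<open>(X\<^sub>t, Y\<^sub>t, U\<^sub>t)\<^sub>t\<close>, composed from the conditional laws by the
  Ionescu-Tulcea theorem (the projective limit of the finite-dimensional laws \<open>CI\<close>). The lemma
  below discharges the hypotheses of that theorem.
\<close>

definition process_law ::
  "'x::topological_space set \<Rightarrow> 'y::topological_space set \<Rightarrow> 'u::topological_space set
   \<Rightarrow> ('x \<Rightarrow> 'y measure) \<Rightarrow> 'x measure \<Rightarrow> ('x \<times> 'u \<Rightarrow> 'x measure) \<Rightarrow> ('y, 'u) policy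
   \<Rightarrow> (nat \<Rightarrow> 'x \<times> 'y \<times> 'u) measure" where
  "process_law X Y U Q P T \<gamma> =
     projective_family.lim UNIV
       (Ionescu_Tulcea.CI (stage_law X Y U Q P T \<gamma>) (\<lambda>_. stage_space X Y U))
       (\<lambda>_. stage_space X Y U)"

lemma measurable_info:
  "(\<lambda>(\<omega>, y). info t \<omega> y) \<in>
     (\<Pi>\<^sub>M i\<in>{0..<t}. stage_space X Y U) \<Otimes>\<^sub>M borel_on Y \<rightarrow>\<^sub>M
     (\<Pi>\<^sub>M i\<in>{0..t}. borel_on Y) \<Otimes>\<^sub>M (\<Pi>\<^sub>M i\<in>{0..<t}. borel_on U)"
proof -
  let ?H = "(\<Pi>\<^sub>M i\<in>{0..<t}. stage_space X Y U) \<Otimes>\<^sub>M borel_on Y"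
  have comp: "(\<lambda>z. fst z i) \<in> ?H \<rightarrow>\<^sub>M stage_space X Y U" if "i < t" for i
    by (rule measurable_compose[OF measurable_fst measurable_component_singleton]) (use that in simp)
  have "(\<lambda>z. if i = t then snd z else meas_at (fst z) i) \<in> ?H \<rightarrow>\<^sub>M borel_on Y"
    if "i \<in> {0..t}" for i
    using that comp[of i]
    by (cases "i = t") (auto intro: measurable_compose[OF _ measurable_fst] measurable_compose[OF _ measurable_snd])
  moreover have "(\<lambda>z. action_at (fst z) i) \<in> ?H \<rightarrow>\<^sub>M borel_on U" if "i \<in> {0..<t}" for i
    using that comp[of i] by (auto intro: measurable_compose[OF _ measurable_snd])
  ultimately show ?thesis
    unfolding info_def case_prod_beta by (intro measurable_Pair measurable_restrict)
qed

lemma Ionescu_Tulcea_stage_law: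
  assumes Q: "stochastic_kernel (borel_on X) (borel_on Y) Q"
    and T: "stochastic_kernel (borel_on X \<Otimes>\<^sub>M borel_on U) (borel_on X) T"
    and P: "P \<in> borel_probs X" and \<gamma>: "\<gamma> \<in> admissible_policies Y U"
  shows "Ionescu_Tulcea (stage_law X Y U Q P T \<gamma>) (\<lambda>_. stage_space X Y U)"
proof -
  have K: "stage_law X Y U Q P T \<gamma> t \<in> (\<Pi>\<^sub>M i\<in>{0..<t}. stage_space X Y U) \<rightarrow>\<^sub>M
      prob_algebra (stage_space X Y U)" for t
  proof -
    let ?H = "\<Pi>\<^sub>M i\<in>{0..<t}. stage_space X Y U"
    have Q': "(\<lambda>z. Q (snd z)) \<in> ?H \<Otimes>\<^sub>M borel_on X \<rightarrow>\<^sub>M prob_algebra (borel_on Y)"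
      using Q unfolding stochastic_kernel_def by (rule measurable_compose[OF measurable_snd])
    have T': "(\<lambda>\<omega>. if t = 0 then P else T (state_at \<omega> (t - 1), action_at \<omega> (t - 1)))
        \<in> ?H \<rightarrow>\<^sub>M prob_algebra (borel_on X)"
    proof (cases "t = 0")
      case True
      then show ?thesis using P by simp
    next
      case False
      then have c: "(\<lambda>\<omega>. \<omega> (t - 1)) \<in> ?H \<rightarrow>\<^sub>M stage_space X Y U"
        by (intro measurable_component_singleton) auto
      have "(\<lambda>\<omega>. (state_at \<omega> (t - 1), action_at \<omega> (t - 1))) \<in> ?H \<rightarrow>\<^sub>M borel_on X \<Otimes>\<^sub>M borel_on U"
        by (intro measurable_Pair measurable_compose[OF c measurable_fst]
            measurable_compose[OF measurable_compose[OF c measurable_snd] measurable_snd])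
      then show ?thesis
        using False T unfolding stochastic_kernel_def by (simp add: measurable_compose)
    qed
    let ?HXY = "(?H \<Otimes>\<^sub>M borel_on X) \<Otimes>\<^sub>M borel_on Y"
    have "(\<lambda>z. (fst (fst z), snd z)) \<in> ?HXY \<rightarrow>\<^sub>M ?H \<Otimes>\<^sub>M borel_on Y"
      by measurable
    from measurable_compose[OF this measurable_info]
    have "(\<lambda>z. info t (fst (fst z)) (snd z)) \<in> ?HXY \<rightarrow>\<^sub>M
        (\<Pi>\<^sub>M i\<in>{0..t}. borel_on Y) \<Otimes>\<^sub>M (\<Pi>\<^sub>M i\<in>{0..<t}. borel_on U)"
      by simp
    moreover have "\<gamma> t \<in> (\<Pi>\<^sub>M i\<in>{0..t}. borel_on Y) \<Otimes>\<^sub>M (\<Pi>\<^sub>M i\<in>{0..<t}. borel_on U) \<rightarrow>\<^sub>M borel_on U"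
      using \<gamma> by (simp add: admissible_policies_def)
    ultimately have "(\<lambda>z. \<gamma> t (info t (fst (fst z)) (snd z))) \<in> ?HXY \<rightarrow>\<^sub>M borel_on U"
      by (rule measurable_compose)
    then have "(\<lambda>z. (snd (fst z), snd z, \<gamma> t (info t (fst (fst z)) (snd z))))
        \<in> ?HXY \<rightarrow>\<^sub>M stage_space X Y U"
      by (intro measurable_Pair) measurable
    then have R: "(\<lambda>z. return (stage_space X Y U)
          (snd (fst z), snd z, \<gamma> t (info t (fst (fst z)) (snd z))))
        \<in> ?HXY \<rightarrow>\<^sub>M prob_algebra (stage_space X Y U)"
      by (rule measurable_compose[OF _ measurable_return_prob_space])
    show ?thesis
      unfolding stage_law_def[abs_def]
      by (rule measurable_bind_prob_space2[OF T'], unfold case_prod_beta,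
          rule measurable_bind_prob_space2[OF Q'], unfold case_prod_beta, rule R)
  qed
  show ?thesis
    by (rule Ionescu_Tulcea.intro, rule measurable_prob_algebraD[OF K])
      (use measurable_space[OF K] in \<open>unfold space_prob_algebra, blast\<close>)
qed

definition discounted_cost ::
  "'x::topological_space set \<Rightarrow> 'y::topological_space set \<Rightarrow> 'u::topological_space set
   \<Rightarrow> ('x \<Rightarrow> 'y measure) \<Rightarrow> ('x \<times> 'u \<Rightarrow> real) \<Rightarrow> real
   \<Rightarrow> 'x measure \<Rightarrow> ('x \<times> 'u \<Rightarrow> 'x measure) \<Rightarrow> ('y, 'u) policy \<Rightarrow> real" where
  "discounted_cost X Y U Q c \<beta> P T \<gamma> =
     (\<integral>\<omega>. (\<Sum>t. \<beta> ^ t * c (state_at \<omega> t, action_at \<omega> t)) \<partial>process_law X Y U Q P T \<gamma>)"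

definition optimal_cost ::
  "'x::topological_space set \<Rightarrow> 'y::topological_space set \<Rightarrow> 'u::topological_space set
   \<Rightarrow> ('x \<Rightarrow> 'y measure) \<Rightarrow> ('x \<times> 'u \<Rightarrow> real) \<Rightarrow> real
   \<Rightarrow> 'x measure \<Rightarrow> ('x \<times> 'u \<Rightarrow> 'x measure) \<Rightarrow> real" where
  "optimal_cost X Y U Q c \<beta> P T =
     (INF \<gamma>\<in>admissible_policies Y U. discounted_cost X Y U Q c \<beta> P T \<gamma>)"

end

theory Submission
  imports Defs
begin

text \<open>
  For a fixed policy the initial law enters the process only through the law of \<open>X\<^sub>0\<close>: the expected
  cost at time \<open>t\<close> is the integral against \<open>P\<close> of a function of the initial state that does not
  depend on \<open>P\<close> and has values in \<open>[0, \<parallel>c\<parallel>]\<close>. Replacing \<open>P\<close> by \<open>P'\<close> therefore changes it by at most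
  half the total variation distance times \<open>\<parallel>c\<parallel>\<close>. Summing over \<open>t\<close> with weights \<open>\<beta>\<^sup>t\<close> gives a bound
  that is uniform in the policy, so it passes to the infimum.
\<close>

section \<open>Total variation distance and supremum norm\<close>

lemma abs_measure_diff_le_tv_dist:
  assumes "prob_space \<mu>" "prob_space \<nu>" "B \<in> sets \<mu>"
  shows "\<bar>measure \<mu> B - measure \<nu> B\<bar> \<le> tv_dist \<mu> \<nu> / 2"
proof -
  \<comment> \<open>A real supremum dominates its members only if the set is bounded above; for
    probability measures the bound 1 provides this.\<close>
  have "\<bar>measure \<mu> A - measure \<nu> A\<bar> \<le> 1" for A
    using prob_space.prob_le_1[OF assms(1), of A] prob_space.prob_le_1[OF assms(2), of A]
      measure_nonneg[of \<mu> A] measure_nonneg[of \<nu> A] by linarith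
  then have "\<bar>measure \<mu> B - measure \<nu> B\<bar> \<le> (SUP B\<in>sets \<mu>. \<bar>measure \<mu> B - measure \<nu> B\<bar>)"
    using assms(3) by (intro cSUP_upper) (auto intro!: bdd_aboveI[of _ 1])
  then show ?thesis by (simp add: tv_dist_def)
qed

lemma tv_dist_nonneg: "prob_space \<mu> \<Longrightarrow> prob_space \<nu> \<Longrightarrow> 0 \<le> tv_dist \<mu> \<nu>"
  using abs_measure_diff_le_tv_dist[of \<mu> \<nu> "{}"] by simp

lemma tv_dist_commute: "sets \<mu> = sets \<nu> \<Longrightarrow> tv_dist \<mu> \<nu> = tv_dist \<nu> \<mu>"
  by (simp add: tv_dist_def abs_minus_commute)

lemma abs_le_sup_norm_on:
  assumes "bounded (f ` A)" "z \<in> A"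
  shows "\<bar>f z\<bar> \<le> sup_norm_on A f"
proof -
  obtain b where b: "\<And>z. z \<in> A \<Longrightarrow> \<bar>f z\<bar> \<le> b"
    using assms(1) by (auto simp: bounded_iff)
  then have "bdd_above (insert 0 ((\<lambda>z. \<bar>f z\<bar>) ` A))"
    by (auto intro!: bdd_aboveI[of _ b])
  then show ?thesis
    unfolding sup_norm_on_def using assms(2) by (intro cSup_upper) auto
qed

lemma sup_norm_on_nonneg:
  assumes "bounded (f ` A)"
  shows "0 \<le> sup_norm_on A f"
proof (cases "A = {}")
  case True
  then show ?thesis by (simp add: sup_norm_on_def)
next
  case False
  then show ?thesis using abs_le_sup_norm_on[OF assms] by (meson abs_ge_zero all_not_in_conv order_trans)
qed

section \<open>Integrals of one bounded function under two initial laws\<close>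

text \<open>Weighting both measures with \<open>indicator A\<close> turns domination on subsets of
  \<open>A\<close> into the order of measures, in which the integral is monotone. It serves on both
  halves of a Hahn decomposition.\<close>

lemma nn_integral_indicator_mono_measure:
  assumes sets: "sets M = sets N" and A: "A \<in> sets M"
    and le: "\<And>B. B \<in> sets M \<Longrightarrow> B \<subseteq> A \<Longrightarrow> emeasure M B \<le> emeasure N B"
    and f: "f \<in> borel_measurable M"
  shows "(\<integral>\<^sup>+x. f x * indicator A x \<partial>M) \<le> (\<integral>\<^sup>+x. f x * indicator A x \<partial>N)"
proof -
  have fN: "f \<in> borel_measurable N" and AN: "A \<in> sets N"
    using f A sets by (auto cong: measurable_cong_sets)
  have "density M (indicator A) \<le> density N (indicator A)"
  proof (subst le_measure)
    show "\<forall>B\<in>sets (density M (indicator A)).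
        emeasure (density M (indicator A)) B \<le> emeasure (density N (indicator A)) B"
    proof
      fix B assume "B \<in> sets (density M (indicator A))"
      then have B: "B \<in> sets M" "B \<in> sets N" using sets by auto
      have "emeasure M (A \<inter> B) \<le> emeasure N (A \<inter> B)"
        using A B by (intro le) auto
      then show "emeasure (density M (indicator A)) B \<le> emeasure (density N (indicator A)) B"
        using A AN B by (simp add: emeasure_density indicator_inter_arith[symmetric])
    qed
  qed (use sets in simp)
  then have "nn_integral (density M (indicator A)) f \<le> nn_integral (density N (indicator A)) f"
    using sets by (intro nn_integral_mono_measure) auto
  then show ?thesis
    using f A fN AN by (simp add: nn_integral_density mult.commute)
qed

text \<open>
  On a Hahn set \<open>H\<close>, where \<open>\<mu>\<close> dominates \<open>\<nu>\<close>, the difference of the integrals is estimated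
  through \<open>K - h\<close>; off \<open>H\<close> it is non-positive.
\<close>

lemma nn_integral_le_tv_dist:
  assumes \<mu>: "prob_space \<mu>" and \<nu>: "prob_space \<nu>" and sets: "sets \<nu> = sets \<mu>"
    and h[measurable]: "h \<in> borel_measurable \<mu>"
    and K: "0 \<le> K" and hK: "\<And>x. x \<in> space \<mu> \<Longrightarrow> h x \<le> ennreal K"
  shows "(\<integral>\<^sup>+x. h x \<partial>\<mu>) \<le> (\<integral>\<^sup>+x. h x \<partial>\<nu>) + ennreal (K * (tv_dist \<mu> \<nu> / 2))"
proof -
  interpret \<mu>: prob_space \<mu> by fact
  interpret \<nu>: prob_space \<nu> by fact
  note meas_eq = measurable_cong_sets[OF sets refl]
  obtain H where H: "H \<in> sets \<mu>"
    and in_H: "\<And>B. B \<in> sets \<mu> \<Longrightarrow> B \<subseteq> H \<Longrightarrow> emeasure \<nu> B \<le> emeasure \<mu> B"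
    and off_H: "\<And>B. B \<in> sets \<mu> \<Longrightarrow> B \<inter> H = {} \<Longrightarrow> emeasure \<mu> B \<le> emeasure \<nu> B"
    using finite_unsigned_Hahn_decomposition[OF \<mu>.finite_measure_axioms \<nu>.finite_measure_axioms sets]
    by blast
  define H' where "H' = space \<mu> - H"
  have H': "H' \<in> sets \<mu>" using H by (simp add: H'_def)
  let ?I = "\<lambda>M A f. \<integral>\<^sup>+x. f x * indicator A x \<partial>M"
  have split: "nn_integral M h = ?I M H h + ?I M H' h" if [simp]: "sets M = sets \<mu>" for M
  proof -
    have [simp]: "space M = space \<mu>" using that by (rule sets_eq_imp_space_eq)
    have "nn_integral M h = (\<integral>\<^sup>+x. h x * indicator H x + h x * indicator H' x \<partial>M)"
      by (rule nn_integral_cong) (auto simp: H'_def split: split_indicator)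
    also have "\<dots> = ?I M H h + ?I M H' h"
      using h H H' by (intro nn_integral_add borel_measurable_times_ennreal borel_measurable_indicator)
        (simp_all add: measurable_cong_sets[OF that refl])
    finally show ?thesis .
  qed
  let ?k = "\<lambda>x. ennreal K - h x"
  \<comment> \<open>Subtraction in \<open>ennreal\<close> is truncated; the bound \<open>hK\<close>
    makes \<open>h\<close> and \<open>?k\<close> add up to exactly \<open>K\<close>.\<close>
  have KH: "?I M H h + ?I M H ?k = ennreal K * emeasure M H" if [simp]: "sets M = sets \<mu>" for M
  proof -
    have [simp]: "space M = space \<mu>" using that by (rule sets_eq_imp_space_eq)
    have [measurable]: "h \<in> borel_measurable M" "H \<in> sets M"
      using h H by (simp_all add: measurable_cong_sets[OF that refl])
    have "?I M H h + ?I M H ?k = (\<integral>\<^sup>+x. h x * indicator H x + ?k x * indicator H x \<partial>M)"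
      by (intro nn_integral_add[symmetric]) measurable
    also have "\<dots> = (\<integral>\<^sup>+x. ennreal K * indicator H x \<partial>M)"
      using hK by (intro nn_integral_cong)
        (auto split: split_indicator intro: add_diff_inverse_ennreal)
    finally show ?thesis using H by (simp add: nn_integral_cmult_indicator)
  qed
  \<comment> \<open>Cancelling this term at the end is valid in \<open>ennreal\<close> only because
    it is finite.\<close>
  have fin: "?I \<nu> H ?k \<noteq> top"
  proof -
    have "?I \<nu> H ?k \<le> ?I \<nu> H h + ?I \<nu> H ?k" by simp
    also have "\<dots> < top" using sets by (simp add: KH \<nu>.emeasure_eq_measure ennreal_mult_less_top)
    finally show ?thesis by simp
  qed
  have "?I \<nu> H ?k \<le> ?I \<mu> H ?k"
    using sets H in_H by (intro nn_integral_indicator_mono_measure) (auto simp: meas_eq)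
  then have "?I \<mu> H h + ?I \<nu> H ?k \<le> ennreal K * emeasure \<mu> H"
    unfolding KH[OF refl, symmetric] by (rule add_left_mono)
  \<comment> \<open>Only the masses of the single set \<open>H\<close> remain to be compared, which
    costs half of \<open>tv_dist\<close>.\<close>
  also have "\<dots> \<le> ennreal K * emeasure \<nu> H + ennreal (K * (tv_dist \<mu> \<nu> / 2))"
  proof -
    have "measure \<mu> H \<le> measure \<nu> H + tv_dist \<mu> \<nu> / 2"
      using abs_measure_diff_le_tv_dist[OF \<mu> \<nu> H] by linarith
    then have "K * measure \<mu> H \<le> K * measure \<nu> H + K * (tv_dist \<mu> \<nu> / 2)"
      using K by (metis distrib_left mult_left_mono)
    then show ?thesis
      using K tv_dist_nonneg[OF \<mu> \<nu>]
      by (simp add: \<mu>.emeasure_eq_measure \<nu>.emeasure_eq_measure ennreal_mult[symmetric]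
          flip: ennreal_plus)
  qed
  also have "\<dots> = (?I \<nu> H h + ennreal (K * (tv_dist \<mu> \<nu> / 2))) + ?I \<nu> H ?k"
    using KH[OF sets] by (simp add: ac_simps)
  finally have "?I \<mu> H h \<le> ?I \<nu> H h + ennreal (K * (tv_dist \<mu> \<nu> / 2))"
    using fin by (simp add: ennreal_add_left_cancel_le add.commute[of _ "?I \<nu> H ?k"])
  moreover have "?I \<mu> H' h \<le> ?I \<nu> H' h"
    using sets H' off_H by (intro nn_integral_indicator_mono_measure) (auto simp: H'_def)
  ultimately have "nn_integral \<mu> h \<le> (?I \<nu> H h + ennreal (K * (tv_dist \<mu> \<nu> / 2))) + ?I \<nu> H' h"
    unfolding split[OF refl] by (rule add_mono)
  also have "\<dots> = nn_integral \<nu> h + ennreal (K * (tv_dist \<mu> \<nu> / 2))"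
    unfolding split[OF sets] by (simp add: ac_simps)
  finally show ?thesis .
qed

lemma nn_integral_le_bound:
  assumes "prob_space M" "\<And>x. x \<in> space M \<Longrightarrow> f x \<le> k"
  shows "(\<integral>\<^sup>+x. f x \<partial>M) \<le> (k :: ennreal)"
proof -
  have "(\<integral>\<^sup>+x. f x \<partial>M) \<le> (\<integral>\<^sup>+x. k \<partial>M)" using assms(2) by (rule nn_integral_mono)
  then show ?thesis using prob_space.emeasure_space_1[OF assms(1)] by simp
qed

text \<open>A common kernel does not enlarge the bound: averaging \<open>g\<close> over the
  probability measures \<open>N x\<close> gives again a function with values between 0 and
  \<open>K\<close>, to be integrated against \<open>P\<close> and \<open>P'\<close>.\<close>

lemma nn_integral_bind_le_tv_dist:
  assumes P: "P \<in> space (prob_algebra M)" "P' \<in> space (prob_algebra M)"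
    and N: "N \<in> M \<rightarrow>\<^sub>M prob_algebra S"
    and g: "g \<in> borel_measurable S"
    and K: "0 \<le> K" and gK: "\<And>s. s \<in> space S \<Longrightarrow> g s \<le> ennreal K"
  shows "(\<integral>\<^sup>+s. g s \<partial>(P \<bind> N)) \<le> (\<integral>\<^sup>+s. g s \<partial>(P' \<bind> N)) + ennreal (K * (tv_dist P P' / 2))"
proof -
  have sets: "sets P = sets M" "sets P' = sets M" and pr: "prob_space P" "prob_space P'"
    using P by (auto simp: space_prob_algebra)
  note NS = measurable_prob_algebraD[OF N]
  have bind: "(\<integral>\<^sup>+s. g s \<partial>(R \<bind> N)) = (\<integral>\<^sup>+x. \<integral>\<^sup>+s. g s \<partial>N x \<partial>R)" if "sets R = sets M" for R
    using g NS that by (intro nn_integral_bind) (auto cong: measurable_cong_sets)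
  have "(\<lambda>x. \<integral>\<^sup>+s. g s \<partial>N x) \<in> borel_measurable P"
    using measurable_compose[OF NS nn_integral_measurable_subprob_algebra[OF g]] sets
    by (simp cong: measurable_cong_sets)
  moreover have "(\<integral>\<^sup>+s. g s \<partial>N x) \<le> ennreal K" if "x \<in> space P" for x
  proof -
    have "N x \<in> space (prob_algebra S)"
      using that sets_eq_imp_space_eq[OF sets(1)] measurable_space[OF N] by auto
    then show ?thesis
      using gK by (intro nn_integral_le_bound) (auto simp: space_prob_algebra dest: sets_eq_imp_space_eq)
  qed
  ultimately show ?thesis
    unfolding bind[OF sets(1)] bind[OF sets(2)]
    using pr sets K by (intro nn_integral_le_tv_dist) auto
qed

section \<open>Conditioning the trajectory law on the first stage\<close>

text \<open>The projective limit is known on cylinder sets through \<open>CI\<close>, and on an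
  initial segment of times \<open>CI\<close> is \<open>C\<close> started from the empty history,
  which is encoded as \<open>\<lambda>_. undefined\<close>.\<close>

lemma (in Ionescu_Tulcea) distr_lim_restrict:
  "distr PF.lim (PiM {0..<n} M) (\<lambda>\<omega>. restrict \<omega> {0..<n}) = C 0 n (\<lambda>_. undefined)"
proof (rule measure_eqI)
  have W: "(\<lambda>_. undefined) \<in> space (PiM {0..<0} M)" by (simp add: space_PiM)
  show "sets (distr PF.lim (PiM {0..<n} M) (\<lambda>\<omega>. restrict \<omega> {0..<n})) = sets (C 0 n (\<lambda>_. undefined))"
    using sets_C[OF W] by simp
  fix A assume "A \<in> sets (distr PF.lim (PiM {0..<n} M) (\<lambda>\<omega>. restrict \<omega> {0..<n}))"
  then have A: "A \<in> sets (PiM {0..<n} M)" by simp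
  have "(\<lambda>\<omega>. restrict \<omega> {0..<n}) \<in> PF.lim \<rightarrow>\<^sub>M PiM {0..<n} M"
    by (simp add: measurable_cong_sets[OF PF.sets_lim refl] measurable_restrict_subset)
  then have "emeasure (distr PF.lim (PiM {0..<n} M) (\<lambda>\<omega>. restrict \<omega> {0..<n})) A
      = emeasure PF.lim (PF.emb UNIV {0..<n} A)"
    using A by (simp add: emeasure_distr prod_emb_def PF.space_lim space_PiM)
  also have "\<dots> = emeasure (CI {0..<n}) A" using A by (intro lim) auto
  also have "\<dots> = emeasure (C 0 n (\<lambda>_. undefined)) (PF.emb {0..<n} {0..<n} A)"
    using A by (intro emeasure_CI) auto
  also have "PF.emb {0..<n} {0..<n} A = A"
    using sets.sets_into_space[OF A] by (simp add: prod_emb_id space_PiM)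
  finally show "emeasure (distr PF.lim (PiM {0..<n} M) (\<lambda>\<omega>. restrict \<omega> {0..<n})) A
      = emeasure (C 0 n (\<lambda>_. undefined)) A" .
qed

text \<open>An image measure keeps the total mass, so it suffices to look at the image on the empty
  segment, where \<open>C 0 0\<close> is a probability measure.\<close>

lemma (in Ionescu_Tulcea) prob_space_lim: "prob_space PF.lim"
proof (rule prob_space_distrD)
  show "(\<lambda>\<omega>. restrict \<omega> {0..<0}) \<in> PF.lim \<rightarrow>\<^sub>M PiM {0..<0} M"
    unfolding measurable_cong_sets[OF PF.sets_lim refl] by (rule measurable_restrict_subset) simp
  show "prob_space (distr PF.lim (PiM {0..<0} M) (\<lambda>\<omega>. restrict \<omega> {0..<0}))"
    unfolding distr_lim_restrict by (rule prob_space_C) (simp add: space_PiM)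
qed

lemma (in Ionescu_Tulcea) measurable_nn_integral_C_component:
  assumes "f \<in> borel_measurable (M t)"
  shows "(\<lambda>\<omega>. \<integral>\<^sup>+\<omega>'. f (\<omega>' t) \<partial>C 1 t \<omega>) \<in> borel_measurable (PiM {0..<1} M)"
proof -
  have "(\<lambda>\<omega>. f (\<omega> t)) \<in> borel_measurable (PiM {0..<1+t} M)"
    using assms by (intro measurable_compose[OF measurable_component_singleton]) auto
  from measurable_compose[OF measurable_C nn_integral_measurable_subprob_algebra[OF this]]
  show ?thesis .
qed

text \<open>The coordinate \<open>t\<close> is visible in the first \<open>1 + t\<close>
  coordinates, and their law splits into stage zero followed by the kernels \<open>C 1 t\<close>.
  This isolates \<open>P 0\<close>, the only kernel through which the initial law will
  enter.\<close>

lemma (in Ionescu_Tulcea) nn_integral_lim_component: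
  assumes f: "f \<in> borel_measurable (M t)"
  shows "(\<integral>\<^sup>+\<omega>. f (\<omega> t) \<partial>PF.lim)
    = (\<integral>\<^sup>+s. \<integral>\<^sup>+\<omega>. f (\<omega> t) \<partial>C 1 t ((\<lambda>_. undefined)(0 := s)) \<partial>P 0 (\<lambda>_. undefined))"
proof -
  let ?W = "\<lambda>_. undefined"
  have W: "?W \<in> space (PiM {0..<0} M)" by (simp add: space_PiM)
  have ft: "(\<lambda>\<omega>. f (\<omega> t)) \<in> borel_measurable (PiM {0..<1+t} M)"
    using f by (intro measurable_compose[OF measurable_component_singleton]) auto
  have r: "(\<lambda>\<omega>. restrict \<omega> {0..<1+t}) \<in> PF.lim \<rightarrow>\<^sub>M PiM {0..<1+t} M"
    unfolding measurable_cong_sets[OF PF.sets_lim refl] by (rule measurable_restrict_subset) simp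
  have "(\<integral>\<^sup>+\<omega>. f (\<omega> t) \<partial>PF.lim) = (\<integral>\<^sup>+\<omega>. f (restrict \<omega> {0..<1+t} t) \<partial>PF.lim)"
    by simp
  also have "\<dots> = (\<integral>\<^sup>+\<omega>. f (\<omega> t) \<partial>distr PF.lim (PiM {0..<1+t} M) (\<lambda>\<omega>. restrict \<omega> {0..<1+t}))"
    by (intro nn_integral_distr[symmetric]) (use r ft in \<open>simp_all only: measurable_distr_eq1\<close>)
  also have "\<dots> = (\<integral>\<^sup>+\<omega>. f (\<omega> t) \<partial>(C 0 1 ?W \<bind> C 1 t))"
    using split_C[OF W, of 1 t] by (simp only: distr_lim_restrict add_0)
  also have "\<dots> = (\<integral>\<^sup>+\<omega>'. \<integral>\<^sup>+\<omega>. f (\<omega> t) \<partial>C 1 t \<omega>' \<partial>C 0 1 ?W)"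
    using ft measurable_C[of 1 t] W
    by (intro nn_integral_bind[where B="PiM {0..<1+t} M"])
       (simp_all add: measurable_cong_sets[OF sets_C refl] del: C.simps)
  \<comment> \<open>One step of the recursion: \<open>C 0 0\<close> is the point mass at the empty
    history, so binding it with \<open>eP 0\<close> merely evaluates \<open>eP 0\<close>
    there.\<close>
  also have "C 0 1 ?W = eP 0 ?W"
    using bind_return[OF measurable_eP W] by simp
  also have "(\<integral>\<^sup>+\<omega>'. \<integral>\<^sup>+\<omega>. f (\<omega> t) \<partial>C 1 t \<omega>' \<partial>eP 0 ?W)
      = (\<integral>\<^sup>+s. \<integral>\<^sup>+\<omega>. f (\<omega> t) \<partial>C 1 t (?W(0 := s)) \<partial>P 0 ?W)"
    using measurable_nn_integral_C_component[OF f] by (intro nn_integral_eP[OF W]) simp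
  finally show ?thesis .
qed

text \<open>The recursion for \<open>C n m\<close> composes only kernels with index at least
  \<open>n\<close>. With \<open>n = 1\<close> this compares processes that differ in their initial
  law.\<close>

lemma Ionescu_Tulcea_C_cong:
  assumes "Ionescu_Tulcea K M" "Ionescu_Tulcea K' M" "\<And>i. n \<le> i \<Longrightarrow> K i = K' i"
  shows "Ionescu_Tulcea.C K M n m = Ionescu_Tulcea.C K' M n m"
proof -
  interpret A: Ionescu_Tulcea K M by fact
  interpret B: Ionescu_Tulcea K' M by fact
  have "A.eP (n + m) = B.eP (n + m)" for m
    using assms(3) by (simp add: A.eP_def B.eP_def fun_eq_iff)
  then have "A.C n m \<omega> = B.C n m \<omega>" for \<omega>
    by (induction m) simp_all
  then show ?thesis by (simp add: fun_eq_iff)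
qed

section \<open>Dependence of the expected stage costs on the initial law\<close>

text \<open>This kernel carries the initial state to the whole of stage zero:
  \<open>stage_law\<close> at time 0 is the initial law bound with it.\<close>

lemma measurable_initial_stage:
  fixes X :: "'x::topological_space set" and Y :: "'y::topological_space set"
    and U :: "'u::topological_space set"
  assumes Q: "stochastic_kernel (borel_on X) (borel_on Y) Q"
    and \<gamma>: "\<gamma> \<in> admissible_policies Y U"
  shows "(\<lambda>x. Q x \<bind> (\<lambda>y. return (stage_space X Y U) (x, y, \<gamma> 0 (info 0 (\<lambda>_. undefined :: 'x \<times> 'y \<times> 'u) y))))
    \<in> borel_on X \<rightarrow>\<^sub>M prob_algebra (stage_space X Y U)"
proof -
  let ?W = "\<lambda>_. undefined :: 'x \<times> 'y \<times> 'u"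
  have "?W \<in> space (\<Pi>\<^sub>M i\<in>{0..<0::nat}. stage_space X Y U)" by (simp add: space_PiM)
  then have "(\<lambda>y. (?W, y)) \<in> borel_on Y \<rightarrow>\<^sub>M (\<Pi>\<^sub>M i\<in>{0..<0::nat}. stage_space X Y U) \<Otimes>\<^sub>M borel_on Y"
    by (intro measurable_Pair measurable_const) auto
  from measurable_compose[OF this measurable_info]
  have "info 0 ?W \<in> borel_on Y \<rightarrow>\<^sub>M
      (\<Pi>\<^sub>M i\<in>{0..0}. borel_on Y) \<Otimes>\<^sub>M (\<Pi>\<^sub>M i\<in>{0..<0}. borel_on U)"
    by simp
  moreover have "\<gamma> 0 \<in> (\<Pi>\<^sub>M i\<in>{0..0}. borel_on Y) \<Otimes>\<^sub>M (\<Pi>\<^sub>M i\<in>{0..<0}. borel_on U) \<rightarrow>\<^sub>M borel_on U"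
    using \<gamma> unfolding admissible_policies_def by blast
  ultimately have G: "(\<lambda>y. \<gamma> 0 (info 0 ?W y)) \<in> borel_on Y \<rightarrow>\<^sub>M borel_on U"
    by (rule measurable_compose)
  have "(\<lambda>z. (fst z, snd z, \<gamma> 0 (info 0 ?W (snd z)))) \<in> borel_on X \<Otimes>\<^sub>M borel_on Y \<rightarrow>\<^sub>M stage_space X Y U"
    by (intro measurable_Pair measurable_compose[OF measurable_snd G]) measurable
  from measurable_compose[OF this measurable_return_prob_space] Q
  show ?thesis
    by (intro measurable_bind_prob_space2[where N="borel_on Y"])
       (auto simp: stochastic_kernel_def split_beta')
qed

text \<open>After conditioning on stage zero, both processes integrate the same bounded function
  against laws obtained from \<open>P\<close> and \<open>P'\<close> by the same kernel.\<close>

lemma nn_integral_process_law_component_le: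
  assumes Q: "stochastic_kernel (borel_on X) (borel_on Y) Q"
    and T: "stochastic_kernel (borel_on X \<Otimes>\<^sub>M borel_on U) (borel_on X) T"
    and P: "P \<in> borel_probs X" "P' \<in> borel_probs X" and \<gamma>: "\<gamma> \<in> admissible_policies Y U"
    and f: "f \<in> borel_measurable (stage_space X Y U)"
    and K: "0 \<le> K" and fK: "\<And>s. s \<in> space (stage_space X Y U) \<Longrightarrow> f s \<le> ennreal K"
  shows "(\<integral>\<^sup>+\<omega>. f (\<omega> t) \<partial>process_law X Y U Q P T \<gamma>)
    \<le> (\<integral>\<^sup>+\<omega>. f (\<omega> t) \<partial>process_law X Y U Q P' T \<gamma>) + ennreal (K * (tv_dist P P' / 2))"
proof -
  let ?S = "stage_space X Y U" and ?W = "\<lambda>_. undefined"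
  interpret A: Ionescu_Tulcea "stage_law X Y U Q P T \<gamma>" "\<lambda>_. ?S"
    by (rule Ionescu_Tulcea_stage_law) fact+
  interpret B: Ionescu_Tulcea "stage_law X Y U Q P' T \<gamma>" "\<lambda>_. ?S"
    by (rule Ionescu_Tulcea_stage_law) fact+
  \<comment> \<open>The conditional expectation of \<open>f (\<omega> t)\<close> given that stage
    zero equals \<open>s\<close>.\<close>
  define g where "g s = (\<integral>\<^sup>+\<omega>. f (\<omega> t) \<partial>A.C 1 t (?W(0 := s)))" for s
  have upd: "(\<lambda>s. ?W(0 := s)) \<in> ?S \<rightarrow>\<^sub>M (\<Pi>\<^sub>M i\<in>{0..<1::nat}. ?S)"
    by (rule measurable_fun_upd[where J="{}"]) (auto simp: space_PiM)
  have g: "g \<in> borel_measurable ?S"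
    unfolding g_def[abs_def]
    using measurable_compose[OF upd A.measurable_nn_integral_C_component[OF f]] by simp
  have gK: "g s \<le> ennreal K" if "s \<in> space ?S" for s
  proof -
    have W: "?W(0 := s) \<in> space (\<Pi>\<^sub>M i\<in>{0..<1::nat}. ?S)"
      using measurable_space[OF upd that] .
    show ?thesis
      unfolding g_def
    proof (rule nn_integral_le_bound)
      show "prob_space (A.C 1 t (?W(0 := s)))" using W by (rule A.prob_space_C)
      fix \<omega> assume "\<omega> \<in> space (A.C 1 t (?W(0 := s)))"
      then have "\<omega> t \<in> space ?S"
        unfolding A.space_C[OF W] by (auto simp: space_PiM PiE_iff)
      then show "f (\<omega> t) \<le> ennreal K" by (rule fK)
    qed
  qed
  \<comment> \<open>The initial law occurs in \<open>stage_law\<close> only at time 0, so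
    \<open>g\<close> is the same function for both processes.\<close>
  have C: "A.C 1 t = B.C 1 t"
    by (rule Ionescu_Tulcea_C_cong)
       (auto simp: stage_law_def fun_eq_iff A.Ionescu_Tulcea_axioms B.Ionescu_Tulcea_axioms)
  have "(\<integral>\<^sup>+\<omega>. f (\<omega> t) \<partial>process_law X Y U Q P T \<gamma>) = (\<integral>\<^sup>+s. g s \<partial>stage_law X Y U Q P T \<gamma> 0 ?W)"
    unfolding process_law_def g_def by (rule A.nn_integral_lim_component[OF f])
  also have "\<dots> \<le> (\<integral>\<^sup>+s. g s \<partial>stage_law X Y U Q P' T \<gamma> 0 ?W) + ennreal (K * (tv_dist P P' / 2))"
    using nn_integral_bind_le_tv_dist[OF P measurable_initial_stage[OF Q \<gamma>] g K gK]
    by (simp add: stage_law_def)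
  also have "(\<integral>\<^sup>+s. g s \<partial>stage_law X Y U Q P' T \<gamma> 0 ?W)
      = (\<integral>\<^sup>+\<omega>. f (\<omega> t) \<partial>process_law X Y U Q P' T \<gamma>)"
    unfolding process_law_def g_def C by (rule B.nn_integral_lim_component[OF f, symmetric])
  finally show ?thesis .
qed

section \<open>The discounted cost as a series of expected stage costs\<close>

lemma
  assumes Q: "stochastic_kernel (borel_on X) (borel_on Y) Q"
    and T: "stochastic_kernel (borel_on X \<Otimes>\<^sub>M borel_on U) (borel_on X) T"
    and P: "P \<in> borel_probs X" and \<gamma>: "\<gamma> \<in> admissible_policies Y U"
  shows prob_space_process_law: "prob_space (process_law X Y U Q P T \<gamma>)"
    and sets_process_law: "sets (process_law X Y U Q P T \<gamma>) = sets (\<Pi>\<^sub>M t\<in>UNIV. stage_space X Y U)"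
proof -
  interpret Ionescu_Tulcea "stage_law X Y U Q P T \<gamma>" "\<lambda>_. stage_space X Y U"
    by (rule Ionescu_Tulcea_stage_law) fact+
  show "prob_space (process_law X Y U Q P T \<gamma>)"
    unfolding process_law_def by (rule prob_space_lim)
  show "sets (process_law X Y U Q P T \<gamma>) = sets (\<Pi>\<^sub>M t\<in>UNIV. stage_space X Y U)"
    unfolding process_law_def by (rule PF.sets_lim)
qed

text \<open>Non-negativity of the cost permits the exchange of series and expectation in
  \<open>ennreal\<close>; the geometric majorant from \<open>K\<close> links the real-valued cost to
  this form.\<close>

lemma
  assumes Q: "stochastic_kernel (borel_on X) (borel_on Y) Q"
    and T: "stochastic_kernel (borel_on X \<Otimes>\<^sub>M borel_on U) (borel_on X) T"
    and P: "P \<in> borel_probs X" and \<gamma>: "\<gamma> \<in> admissible_policies Y U"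
    and \<beta>: "0 \<le> \<beta>" "\<beta> < 1"
    and c: "c \<in> borel_measurable (borel_on X \<Otimes>\<^sub>M borel_on U)"
    and c0: "\<And>z. z \<in> X \<times> U \<Longrightarrow> 0 \<le> c z" and cK: "\<And>z. z \<in> X \<times> U \<Longrightarrow> c z \<le> K"
  shows discounted_cost_nonneg: "0 \<le> discounted_cost X Y U Q c \<beta> P T \<gamma>"
    and ennreal_discounted_cost: "ennreal (discounted_cost X Y U Q c \<beta> P T \<gamma>)
      = (\<Sum>t. ennreal (\<beta> ^ t) * (\<integral>\<^sup>+\<omega>. ennreal (c (state_at \<omega> t, action_at \<omega> t))
          \<partial>process_law X Y U Q P T \<gamma>))"
proof -
  let ?L = "process_law X Y U Q P T \<gamma>"
  let ?c = "\<lambda>t \<omega>. c (state_at \<omega> t, action_at \<omega> t)"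
  let ?F = "\<lambda>\<omega>. \<Sum>t. \<beta> ^ t * ?c t \<omega>"
  interpret L: prob_space ?L by (rule prob_space_process_law) fact+
  have sets: "sets ?L = sets (\<Pi>\<^sub>M t\<in>UNIV. stage_space X Y U)" by (rule sets_process_law) fact+
  have comp: "(\<lambda>\<omega>. \<omega> t) \<in> ?L \<rightarrow>\<^sub>M stage_space X Y U" for t
    unfolding measurable_cong_sets[OF sets refl] by (rule measurable_component_singleton) simp
  have "(\<lambda>\<omega>. (state_at \<omega> t, action_at \<omega> t)) \<in> ?L \<rightarrow>\<^sub>M borel_on X \<Otimes>\<^sub>M borel_on U" for t
    by (intro measurable_Pair measurable_compose[OF comp measurable_fst]
        measurable_compose[OF measurable_compose[OF comp measurable_snd] measurable_snd])
  from measurable_compose[OF this c] have c_meas[measurable]: "?c t \<in> borel_measurable ?L" for t .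
  have in_XU: "(state_at \<omega> t, action_at \<omega> t) \<in> X \<times> U" if "\<omega> \<in> space ?L" for \<omega> t
    using measurable_space[OF comp that, of t] by (auto simp: space_pair_measure space_restrict_space)
  have nonneg: "0 \<le> \<beta> ^ t * ?c t \<omega>" if "\<omega> \<in> space ?L" for \<omega> t
    using c0[OF in_XU[OF that]] \<beta> by simp
  have le: "\<beta> ^ t * ?c t \<omega> \<le> \<beta> ^ t * K" if "\<omega> \<in> space ?L" for \<omega> t
    using cK[OF in_XU[OF that]] \<beta> by (intro mult_left_mono) auto
  have sumK: "summable (\<lambda>t. \<beta> ^ t * K)" using \<beta> by (intro summable_mult2 summable_geometric) simp
  have sum: "summable (\<lambda>t. \<beta> ^ t * ?c t \<omega>)" if "\<omega> \<in> space ?L" for \<omega>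
    using nonneg[OF that] le[OF that] by (intro summable_comparison_test[OF _ sumK] exI[of _ 0]) auto
  have F0: "0 \<le> ?F \<omega>" if "\<omega> \<in> space ?L" for \<omega>
    using sum[OF that] nonneg[OF that] by (rule suminf_nonneg)
  have FK: "?F \<omega> \<le> (\<Sum>t. \<beta> ^ t * K)" if "\<omega> \<in> space ?L" for \<omega>
    using le[OF that] sum[OF that] sumK by (rule suminf_le)
  have F_meas: "?F \<in> borel_measurable ?L" by measurable
  \<comment> \<open>A Bochner integral is 0 by default on non-integrable functions, so integrability
    is what identifies the cost with the \<open>ennreal\<close> integral.\<close>
  have int: "integrable ?L ?F"
    using F0 FK F_meas
    by (intro L.integrable_const_bound[where B="\<Sum>t. \<beta> ^ t * K"] AE_I2) auto
  show "0 \<le> discounted_cost X Y U Q c \<beta> P T \<gamma>"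
    unfolding discounted_cost_def using F0 by (rule Bochner_Integration.integral_nonneg)
  have "ennreal (discounted_cost X Y U Q c \<beta> P T \<gamma>) = (\<integral>\<^sup>+\<omega>. ennreal (?F \<omega>) \<partial>?L)"
    unfolding discounted_cost_def using int F0 by (intro nn_integral_eq_integral[symmetric] AE_I2)
  also have "\<dots> = (\<integral>\<^sup>+\<omega>. (\<Sum>t. ennreal (\<beta> ^ t) * ennreal (?c t \<omega>)) \<partial>?L)"
    using nonneg sum \<beta> c0[OF in_XU]
    by (intro nn_integral_cong) (simp add: suminf_ennreal2[symmetric] ennreal_mult)
  also have "\<dots> = (\<Sum>t. ennreal (\<beta> ^ t) * (\<integral>\<^sup>+\<omega>. ennreal (?c t \<omega>) \<partial>?L))"
    by (subst nn_integral_suminf) (simp_all add: nn_integral_cmult)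
  finally show "ennreal (discounted_cost X Y U Q c \<beta> P T \<gamma>)
      = (\<Sum>t. ennreal (\<beta> ^ t) * (\<integral>\<^sup>+\<omega>. ennreal (?c t \<omega>) \<partial>?L))" .
qed

text \<open>The error at each stage is bounded independently of \<open>t\<close>, so the weights
  \<open>\<beta> ^ t\<close> sum to the factor \<open>1 / (1 - \<beta>)\<close>.\<close>

lemma discounted_cost_le_tv_dist:
  assumes Q: "stochastic_kernel (borel_on X) (borel_on Y) Q"
    and T: "stochastic_kernel (borel_on X \<Otimes>\<^sub>M borel_on U) (borel_on X) T"
    and P: "P \<in> borel_probs X" "P' \<in> borel_probs X" and \<gamma>: "\<gamma> \<in> admissible_policies Y U"
    and \<beta>: "0 \<le> \<beta>" "\<beta> < 1"
    and c: "c \<in> borel_measurable (borel_on X \<Otimes>\<^sub>M borel_on U)"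
    and c0: "\<And>z. z \<in> X \<times> U \<Longrightarrow> 0 \<le> c z" and cK: "\<And>z. z \<in> X \<times> U \<Longrightarrow> c z \<le> K"
    and K: "0 \<le> K"
  shows "discounted_cost X Y U Q c \<beta> P T \<gamma>
    \<le> discounted_cost X Y U Q c \<beta> P' T \<gamma> + tv_dist P P' / 2 * (1 / (1 - \<beta>)) * K"
proof -
  let ?L = "\<lambda>P. process_law X Y U Q P T \<gamma>" and ?J = "\<lambda>P. discounted_cost X Y U Q c \<beta> P T \<gamma>"
  let ?c = "\<lambda>t \<omega>. ennreal (c (state_at \<omega> t, action_at \<omega> t))"
  let ?d = "K * (tv_dist P P' / 2)"
  have d: "0 \<le> ?d"
    using P K by (auto intro!: mult_nonneg_nonneg tv_dist_nonneg simp: space_prob_algebra)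
  have d': "0 \<le> 1 / (1 - \<beta>) * ?d"
    using \<beta> by (intro mult_nonneg_nonneg[OF _ d]) simp
  have J: "ennreal (?J R) = (\<Sum>t. ennreal (\<beta> ^ t) * (\<integral>\<^sup>+\<omega>. ?c t \<omega> \<partial>?L R))" and J0: "0 \<le> ?J R"
    if "R \<in> borel_probs X" for R
    using ennreal_discounted_cost[OF Q T that \<gamma> \<beta> c c0 cK]
      discounted_cost_nonneg[OF Q T that \<gamma> \<beta> c c0 cK] by simp_all
  have "(\<lambda>s. (fst s, snd (snd s))) \<in> stage_space X Y U \<rightarrow>\<^sub>M borel_on X \<Otimes>\<^sub>M borel_on U"
    by measurable
  from measurable_compose[OF this c]
  have f: "(\<lambda>s. ennreal (c (fst s, snd (snd s)))) \<in> borel_measurable (stage_space X Y U)"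
    by measurable
  have step: "(\<integral>\<^sup>+\<omega>. ?c t \<omega> \<partial>?L P) \<le> (\<integral>\<^sup>+\<omega>. ?c t \<omega> \<partial>?L P') + ennreal ?d" for t
    by (rule nn_integral_process_law_component_le[OF Q T P \<gamma> f K])
       (auto simp: space_pair_measure space_restrict_space intro!: ennreal_leI cK)
  have "ennreal (?J P) \<le> (\<Sum>t. ennreal (\<beta> ^ t) * (\<integral>\<^sup>+\<omega>. ?c t \<omega> \<partial>?L P') + ennreal (\<beta> ^ t * ?d))"
    unfolding J[OF P(1)]
  proof (rule suminf_le)
    fix t
    have "ennreal (\<beta> ^ t) * (\<integral>\<^sup>+\<omega>. ?c t \<omega> \<partial>?L P)
        \<le> ennreal (\<beta> ^ t) * ((\<integral>\<^sup>+\<omega>. ?c t \<omega> \<partial>?L P') + ennreal ?d)"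
      by (intro mult_left_mono step) simp
    also have "\<dots> = ennreal (\<beta> ^ t) * (\<integral>\<^sup>+\<omega>. ?c t \<omega> \<partial>?L P') + ennreal (\<beta> ^ t * ?d)"
      using \<beta> d by (subst ennreal_mult) (auto simp: distrib_left)
    finally show "ennreal (\<beta> ^ t) * (\<integral>\<^sup>+\<omega>. ?c t \<omega> \<partial>?L P)
        \<le> ennreal (\<beta> ^ t) * (\<integral>\<^sup>+\<omega>. ?c t \<omega> \<partial>?L P') + ennreal (\<beta> ^ t * ?d)" .
  qed simp_all
  also have "\<dots> = ennreal (?J P') + (\<Sum>t. ennreal (\<beta> ^ t * ?d))"
    unfolding J[OF P(2)] by (rule suminf_add[symmetric]) simp_all
  also have "(\<Sum>t. ennreal (\<beta> ^ t * ?d)) = ennreal (1 / (1 - \<beta>) * ?d)"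
    using \<beta> d by (intro suminf_ennreal_eq sums_mult2 geometric_sums) (simp_all only: zero_le_power mult_nonneg_nonneg, simp)
  also have "ennreal (?J P') + \<dots> = ennreal (?J P' + 1 / (1 - \<beta>) * ?d)"
    using J0[OF P(2)] d' by (rule ennreal_plus[symmetric])
  \<comment> \<open>Both sides are non-negative, so the inequality descends from
    \<open>ennreal\<close> to the reals.\<close>
  finally have "?J P \<le> ?J P' + 1 / (1 - \<beta>) * ?d"
    using J0[OF P(2)] d' by (simp only: ennreal_le_iff add_nonneg_nonneg)
  then show ?thesis by (simp add: mult_ac)
qed

section \<open>Passage to the optimal cost\<close>

text \<open>The error term is the same for every policy, so the optimal cost for \<open>P\<close>
  minus this term is a lower bound of all costs for \<open>P'\<close>, hence of their
  infimum.\<close>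

lemma optimal_cost_le_tv_dist:
  assumes Q: "stochastic_kernel (borel_on X) (borel_on Y) Q"
    and T: "stochastic_kernel (borel_on X \<Otimes>\<^sub>M borel_on U) (borel_on X) T"
    and P: "P \<in> borel_probs X" "P' \<in> borel_probs X"
    and \<beta>: "0 \<le> \<beta>" "\<beta> < 1"
    and c: "c \<in> borel_measurable (borel_on X \<Otimes>\<^sub>M borel_on U)"
    and c0: "\<And>z. z \<in> X \<times> U \<Longrightarrow> 0 \<le> c z" and cK: "\<And>z. z \<in> X \<times> U \<Longrightarrow> c z \<le> K"
    and K: "0 \<le> K"
  shows "optimal_cost X Y U Q c \<beta> P T
    \<le> optimal_cost X Y U Q c \<beta> P' T + tv_dist P P' / 2 * (1 / (1 - \<beta>)) * K"
    (is "_ \<le> _ + ?d")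
proof (cases "admissible_policies Y U = {}")
  \<comment> \<open>Without admissible policies both optimal costs are the same value
    \<open>Inf {}\<close>, and only the sign of the error term matters.\<close>
  case True
  have "0 \<le> ?d"
    using P K \<beta> by (intro mult_nonneg_nonneg) (auto intro: tv_dist_nonneg simp: space_prob_algebra)
  then show ?thesis by (simp add: optimal_cost_def True)
next
  case False
  have "optimal_cost X Y U Q c \<beta> P T - ?d \<le> discounted_cost X Y U Q c \<beta> P' T \<gamma>"
    if \<gamma>: "\<gamma> \<in> admissible_policies Y U" for \<gamma>
  proof -
    have "optimal_cost X Y U Q c \<beta> P T \<le> discounted_cost X Y U Q c \<beta> P T \<gamma>"
      unfolding optimal_cost_def
      using \<gamma> discounted_cost_nonneg[OF Q T P(1) _ \<beta> c c0 cK]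
      by (intro cINF_lower bdd_belowI2[where m=0]) auto
    then show ?thesis
      using discounted_cost_le_tv_dist[OF Q T P \<gamma> \<beta> c c0 cK K] by linarith
  qed
  then have "optimal_cost X Y U Q c \<beta> P T - ?d \<le> optimal_cost X Y U Q c \<beta> P' T"
    unfolding optimal_cost_def[of X Y U Q c \<beta> P'] using False by (intro cINF_greatest)
  then show ?thesis by linarith
qed

theorem theorem2p13:
  fixes X :: "(real ^ 'n) set" and Y :: "(real ^ 'm) set" and U :: "'u::euclidean_space set"
    and Q :: "real ^ 'n \<Rightarrow> (real ^ 'm) measure"
    and T :: "(real ^ 'n) \<times> 'u \<Rightarrow> (real ^ 'n) measure"
    and c :: "(real ^ 'n) \<times> 'u \<Rightarrow> real"
    and \<beta> :: real
  assumes "X \<in> sets borel" and "Y \<in> sets borel" and "U \<in> sets borel"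
    and "stochastic_kernel (borel_on X) (borel_on Y) Q"
    and "stochastic_kernel (borel_on X \<Otimes>\<^sub>M borel_on U) (borel_on X) T"
    and "0 < \<beta>" and "\<beta> < 1"
    and "c \<in> borel_measurable (borel_on X \<Otimes>\<^sub>M borel_on U)"
    and "\<And>z. z \<in> X \<times> U \<Longrightarrow> 0 \<le> c z"
    and "bounded (c ` (X \<times> U))"
  shows "\<forall>P\<^sub>n\<in>borel_probs X. \<forall>P\<in>borel_probs X.
    \<bar>optimal_cost X Y U Q c \<beta> P\<^sub>n T - optimal_cost X Y U Q c \<beta> P T\<bar>
      \<le> tv_dist P\<^sub>n P * (1 / (1 - \<beta>)) * sup_norm_on (X \<times> U) c"
proof (intro ballI)
  fix P\<^sub>n P assume P: "P\<^sub>n \<in> borel_probs X" "P \<in> borel_probs X"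
  define K where "K = sup_norm_on (X \<times> U) c"
  define b where "b = tv_dist P\<^sub>n P * (1 / (1 - \<beta>)) * K"
  have K: "0 \<le> K" unfolding K_def by (rule sup_norm_on_nonneg) fact
  have cK: "c z \<le> K" if "z \<in> X \<times> U" for z
    using abs_le_sup_norm_on[OF assms(10) that] by (simp add: K_def)
  have pr: "prob_space P\<^sub>n" "prob_space P" "sets P\<^sub>n = sets P"
    using P by (auto simp: space_prob_algebra)
  \<comment> \<open>Stated for a general pair so that it serves in both directions. The factor two
    in \<open>tv_dist\<close> leaves only \<open>b / 2\<close> here; non-negativity of
    \<open>b\<close> then weakens this to the claimed bound.\<close>
  have le: "optimal_cost X Y U Q c \<beta> R T \<le> optimal_cost X Y U Q c \<beta> R' T + b / 2"
    if "R \<in> borel_probs X" "R' \<in> borel_probs X" "tv_dist R R' = tv_dist P\<^sub>n P" for R R'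
    using optimal_cost_le_tv_dist[OF assms(4,5) that(1,2) _ assms(7-9) cK K] assms(6) that(3)
    by (simp add: b_def mult.commute)
  have "0 \<le> b"
    unfolding b_def using pr K assms(7) by (intro mult_nonneg_nonneg tv_dist_nonneg) auto
  then have "\<bar>optimal_cost X Y U Q c \<beta> P\<^sub>n T - optimal_cost X Y U Q c \<beta> P T\<bar> \<le> b"
    using le[OF P refl] le[OF P(2,1) tv_dist_commute[OF pr(3), symmetric]] by linarith
  then show "\<bar>optimal_cost X Y U Q c \<beta> P\<^sub>n T - optimal_cost X Y U Q c \<beta> P T\<bar>
      \<le> tv_dist P\<^sub>n P * (1 / (1 - \<beta>)) * sup_norm_on (X \<times> U) c"
    unfolding b_def K_def .
qed

end
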